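(* Consider the optimization model $[M^*]$ and, for a given discretization $(\varrho_i^k)$, the relaxed model $[M_R]$, both defined in the context. Let $\varepsilon>0$. Let $\bm{\nu}$ denote the vector of all decision variables except $\bm{\rho}$, and let $(\bm{\rho}^R,\bm{\nu}^R)$ be an optimal solution of $[M_R]$. For each $i\in\mathcal{N}$, let $k_i\in\mathcal{K}_i$ be such that $\varrho_i^{k_i}\le \rho_i^R\le \varrho_i^{k_i+1}$. Then there exists $S>0$ such that, if $\varrho_i^{k_i+1}-\varrho_i^{k_i}\le S\varepsilon$ for all $i\in\mathcal{N}$, then there is a feasible solution $(\bm{\rho}^R,\tilde{\bm{\nu}})$ of $[M^*]$ (with the same $\bm{\rho}$-component $\bm{\rho}^R$) whose objective value is within $\varepsilon$ of the global optimum, i.e. at most $Z[M^*]+\varepsilon$, where $Z[M^*]$ is the optimal value of $[M^*]$.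
   Context: Data. $\mathcal{R}$ (demand points) and $\mathcal{N}$ (candidate vertiports) are finite sets; $\mathcal{H}$ is a finite set of positive integers; $P$ is a positive integer. Parameters: $D_{od}\ge 0$, $\delta_{o,i,j,d}\in\{0,1\}$, $\xi\in[0,1]$, $Q>0$, $t^f_{i,j}\ge 0$, $b^{\mathrm{fly}},b^{\mathrm{chg}}>0$, $\gamma\in(0,1)$, and nonnegative costs $c^{\mathrm{E}},p^{\mathrm{F}}_{i,j},p^{\mathrm{LT}}_{o,i},p^{\mathrm{LT}}_{j,d}$ ($o,d\in\mathcal{R}$, $i,j\in\mathcal{N}$). Let $f(\rho)=\frac{\rho}{1-\rho}$ for $\rho\in[0,1)$. Model $[M^*]$. Variables: binary $x_i,z_{ih},y_{o,i,j,d}$; integer $\Gamma$; nonnegative real $\rho_i,\alpha_{o,i,j,d},\psi_{i,j},\varphi_{i,j}$ ($o,d\in\mathcal{R}$, $i,j\in\mathcal{N}$, $h\in\mathcal{H}$). Minimize $$\Pi=c^{\mathrm{E}}\Gamma+\sum_{i,j\in\mathcal{N}}p^{\mathrm{F}}_{i,j}(\psi_{i,j}+\varphi_{i,j})+\sum_{o,d\in\mathcal{R}}\sum_{i,j\in\mathcal{N}}D_{od}(p^{\mathrm{LT}}_{o,i}+p^{\mathrm{LT}}_{j,d})\alpha_{o,i,j,d}$$ subject to the linear-type constraints (L): $\sum_i x_i\le P$; $\sum_{h}z_{ih}=x_i$ for all $i$; $\sum_i\sum_h h z_{ih}\ge\Gamma$; $y_{o,i,j,d}\le x_i$, $y_{o,i,j,d}\le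 x_j$, $y_{o,i,j,d}\le\delta_{o,i,j,d}$ for all $o,d,i,j$; $\sum_{i,j}y_{o,i,j,d}\le 1$ for all $o,d$; $\rho_i\le x_i$ for all $i$; $\sum_{o,d}\sum_{i,j}\alpha_{o,i,j,d}D_{od}\ge\xi\sum_{o,d}D_{od}$; $\rho_i-(1-y_{o,i,j,d})\le\alpha_{o,i,j,d}\le\rho_i$ and $\alpha_{o,i,j,d}\le y_{o,i,j,d}$ for all $o,d,i,j$; $\psi_{i,j}=\sum_{o,d}\frac{D_{od}}{Q}\alpha_{o,i,j,d}$ for all $i,j$; $\sum_j(\psi_{j,i}+\varphi_{j,i})=\sum_j(\psi_{i,j}+\varphi_{i,j})$ for all $i$; $\sum_{h}\gamma^{1/h}z_{ih}\rho_i\le\sum_{h}\gamma^{1/(h+1)}z_{ih}$ for all $i$; and the nonlinear constraints (with $\rho_i<1$ so that $f(\rho_i)$ is defined) (F) $\sum_{i}f(\rho_i)+\sum_{i,j}t^f_{i,j}(\psi_{i,j}+\varphi_{i,j})\le\Gamma$; (C) $\frac{b^{\mathrm{fly}}}{b^{\mathrm{chg}}}\sum_j t^f_{i,j}(\psi_{i,j}+\varphi_{i,j})-f(\rho_i)\le 0$ for all $i\in\mathcal{N}$. Discretization. For each $i\in\mathcal{N}$, $\mathcal{K}_i=\{1,\dots,|\mathcal{K}_i|\}$ and $0=\varrho_i^1<\varrho_i^2<\dots<\varrho_i^{|\mathcal{K}_i|+1}=1$. Model $[M_R]$ (relaxed). Same objective and constraints (L), with (F) and (C) replaced, using additional variables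 $\underline\Theta_i\ge0$, $\underline\pi_i^k\ge 0$ and binary $\underline\beta_i^k$ ($i\in\mathcal{N}$, $k\in\mathcal{K}_i$), by: $\underline\Theta_i\ge\frac{\rho_i-(\varrho_i^k)^2}{(1-\varrho_i^k)^2}$ for all $i,k$; $\sum_i\underline\Theta_i+\sum_{i,j}t^f_{i,j}(\psi_{i,j}+\varphi_{i,j})\le\Gamma$; $\frac{b^{\mathrm{fly}}}{b^{\mathrm{chg}}}\sum_j t^f_{i,j}(\psi_{i,j}+\varphi_{i,j})-\sum_{k\in\mathcal{K}_i}\frac{\underline\pi_i^k-\varrho_i^k\varrho_i^{k+1}\underline\beta_i^k}{(1-\varrho_i^k)(1-\varrho_i^{k+1})}\le0$ for all $i$; $\sum_k\varrho_i^k\underline\beta_i^k\le\rho_i\le\sum_k\varrho_i^{k+1}\underline\beta_i^k$ and $\sum_k\underline\beta_i^k=1$ for all $i$; $\rho_i-(1-\underline\beta_i^k)\le\underline\pi_i^k\le\rho_i$ and $\underline\pi_i^k\le\underline\beta_i^k$ for all $i,k$. Convention for the last cell $k=|\mathcal{K}_i|$, where $1-\varrho_i^{k+1}=0$: the corresponding summand is $0$ if $\underline\beta_i^{k}=0$ and $+\infty$ if $\underline\beta_i^{k}=1$ (so the constraint for that $i$ is then vacuous). *)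

theory Defs
  imports Complex_Main "HOL-Library.Extended_Real"
begin

text \<open>Parameters of the vertiport models. The last-mile costs are kept as two functions: \<open>pLTin o i\<close>
  from a demand point to a vertiport, \<open>pLTout j d\<close> from a vertiport to a demand point.\<close>

record ('r, 'n) vp_data =
  demand_points :: "'r set"
  vertiports :: "'n set"
  sizes :: "nat set"
  max_open :: nat
  demand :: "'r \<Rightarrow> 'r \<Rightarrow> real"
  delta :: "'r \<Rightarrow> 'n \<Rightarrow> 'n \<Rightarrow> 'r \<Rightarrow> real"
  xi :: real
  capQ :: real
  tf :: "'n \<Rightarrow> 'n \<Rightarrow> real"
  bfly :: real
  bchg :: real
  gam :: real
  cE :: real
  pF :: "'n \<Rightarrow> 'n \<Rightarrow> real"
  pLTin :: "'r \<Rightarrow> 'n \<Rightarrow> real"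
  pLTout :: "'n \<Rightarrow> 'r \<Rightarrow> real"

definition valid_data :: "('r, 'n) vp_data \<Rightarrow> bool" where
  "valid_data M \<longleftrightarrow>
     finite (demand_points M) \<and> finite (vertiports M) \<and>
     finite (sizes M) \<and> (\<forall>h\<in>sizes M. 0 < h) \<and> 0 < max_open M \<and>
     (\<forall>o'\<in>demand_points M. \<forall>d\<in>demand_points M. 0 \<le> demand M o' d) \<and>
     (\<forall>o'\<in>demand_points M. \<forall>i\<in>vertiports M. \<forall>j\<in>vertiports M. \<forall>d\<in>demand_points M.
        delta M o' i j d \<in> {0, 1}) \<and>
     0 \<le> xi M \<and> xi M \<le> 1 \<and> 0 < capQ M \<and>
     (\<forall>i\<in>vertiports M. \<forall>j\<in>vertiports M. 0 \<le> tf M i j) \<and>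
     0 < bfly M \<and> 0 < bchg M \<and> 0 < gam M \<and> gam M < 1 \<and> 0 \<le> cE M \<and>
     (\<forall>i\<in>vertiports M. \<forall>j\<in>vertiports M. 0 \<le> pF M i j) \<and>
     (\<forall>o'\<in>demand_points M. \<forall>i\<in>vertiports M. 0 \<le> pLTin M o' i) \<and>
     (\<forall>j\<in>vertiports M. \<forall>d\<in>demand_points M. 0 \<le> pLTout M j d)"

definition f_rho :: "real \<Rightarrow> real" where
  "f_rho r = r / (1 - r)"

text \<open>All decision variables except \<open>\<rho>\<close>; the record extension adds those of the relaxed model.
  Only the values at indices in the finite index sets matter.\<close>

record ('r, 'n) vars =
  vx :: "'n \<Rightarrow> real"
  vz :: "'n \<Rightarrow> nat \<Rightarrow> real"
  vy :: "'r \<Rightarrow> 'n \<Rightarrow> 'n \<Rightarrow> 'r \<Rightarrow> real"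
  vGamma :: int
  valpha :: "'r \<Rightarrow> 'n \<Rightarrow> 'n \<Rightarrow> 'r \<Rightarrow> real"
  vpsi :: "'n \<Rightarrow> 'n \<Rightarrow> real"
  vphi :: "'n \<Rightarrow> 'n \<Rightarrow> real"

record ('r, 'n) relaxed_vars = "('r, 'n) vars" +
  vTheta :: "'n \<Rightarrow> real"
  vpi :: "'n \<Rightarrow> nat \<Rightarrow> real"
  vbeta :: "'n \<Rightarrow> nat \<Rightarrow> real"

definition objective :: "('r, 'n) vp_data \<Rightarrow> ('r, 'n, 'e) vars_scheme \<Rightarrow> real" where
  "objective M v =
     cE M * real_of_int (vGamma v)
     + (\<Sum>i\<in>vertiports M. \<Sum>j\<in>vertiports M. pF M i j * (vpsi v i j + vphi v i j))
     + (\<Sum>o'\<in>demand_points M. \<Sum>d\<in>demand_points M. \<Sum>i\<in>vertiports M. \<Sum>j\<in>vertiports M.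
          demand M o' d * (pLTin M o' i + pLTout M j d) * valpha v o' i j d)"

definition var_domains ::
  "('r, 'n) vp_data \<Rightarrow> ('n \<Rightarrow> real) \<Rightarrow> ('r, 'n, 'e) vars_scheme \<Rightarrow> bool" where
  "var_domains M rho v \<longleftrightarrow>
     (\<forall>i\<in>vertiports M. vx v i \<in> {0, 1} \<and> 0 \<le> rho i \<and> (\<forall>h\<in>sizes M. vz v i h \<in> {0, 1})) \<and>
     (\<forall>i\<in>vertiports M. \<forall>j\<in>vertiports M. 0 \<le> vpsi v i j \<and> 0 \<le> vphi v i j) \<and>
     (\<forall>o'\<in>demand_points M. \<forall>i\<in>vertiports M. \<forall>j\<in>vertiports M. \<forall>d\<in>demand_points M.
        vy v o' i j d \<in> {0, 1} \<and> 0 \<le> valpha v o' i j d)"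

definition linear_constraints ::
  "('r, 'n) vp_data \<Rightarrow> ('n \<Rightarrow> real) \<Rightarrow> ('r, 'n, 'e) vars_scheme \<Rightarrow> bool" where
  "linear_constraints M rho v \<longleftrightarrow>
     (\<Sum>i\<in>vertiports M. vx v i) \<le> real (max_open M) \<and>
     (\<forall>i\<in>vertiports M. (\<Sum>h\<in>sizes M. vz v i h) = vx v i) \<and>
     (\<Sum>i\<in>vertiports M. \<Sum>h\<in>sizes M. real h * vz v i h) \<ge> real_of_int (vGamma v) \<and>
     (\<forall>o'\<in>demand_points M. \<forall>d\<in>demand_points M. \<forall>i\<in>vertiports M. \<forall>j\<in>vertiports M.
        vy v o' i j d \<le> vx v i \<and> vy v o' i j d \<le> vx v j \<and> vy v o' i j d \<le> delta M o' i j d) \<and>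
     (\<forall>o'\<in>demand_points M. \<forall>d\<in>demand_points M.
        (\<Sum>i\<in>vertiports M. \<Sum>j\<in>vertiports M. vy v o' i j d) \<le> 1) \<and>
     (\<forall>i\<in>vertiports M. rho i \<le> vx v i) \<and>
     (\<Sum>o'\<in>demand_points M. \<Sum>d\<in>demand_points M. \<Sum>i\<in>vertiports M. \<Sum>j\<in>vertiports M.
        valpha v o' i j d * demand M o' d)
       \<ge> xi M * (\<Sum>o'\<in>demand_points M. \<Sum>d\<in>demand_points M. demand M o' d) \<and>
     (\<forall>o'\<in>demand_points M. \<forall>d\<in>demand_points M. \<forall>i\<in>vertiports M. \<forall>j\<in>vertiports M.
        rho i - (1 - vy v o' i j d) \<le> valpha v o' i j d \<and>
        valpha v o' i j d \<le> rho i \<and> valpha v o' i j d \<le> vy v o' i j d) \<and>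
     (\<forall>i\<in>vertiports M. \<forall>j\<in>vertiports M.
        vpsi v i j = (\<Sum>o'\<in>demand_points M. \<Sum>d\<in>demand_points M.
                        demand M o' d / capQ M * valpha v o' i j d)) \<and>
     (\<forall>i\<in>vertiports M. (\<Sum>j\<in>vertiports M. vpsi v j i + vphi v j i)
                        = (\<Sum>j\<in>vertiports M. vpsi v i j + vphi v i j)) \<and>
     (\<forall>i\<in>vertiports M.
        (\<Sum>h\<in>sizes M. gam M powr (1 / real h) * vz v i h * rho i)
          \<le> (\<Sum>h\<in>sizes M. gam M powr (1 / (real h + 1)) * vz v i h))"

definition feasible_star ::
  "('r, 'n) vp_data \<Rightarrow> ('n \<Rightarrow> real) \<Rightarrow> ('r, 'n) vars \<Rightarrow> bool" where
  "feasible_star M rho v \<longleftrightarrow>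
     var_domains M rho v \<and> linear_constraints M rho v \<and>
     (\<forall>i\<in>vertiports M. rho i < 1) \<and>
     (\<Sum>i\<in>vertiports M. f_rho (rho i))
       + (\<Sum>i\<in>vertiports M. \<Sum>j\<in>vertiports M. tf M i j * (vpsi v i j + vphi v i j))
       \<le> real_of_int (vGamma v) \<and>
     (\<forall>i\<in>vertiports M.
        bfly M / bchg M * (\<Sum>j\<in>vertiports M. tf M i j * (vpsi v i j + vphi v i j))
          - f_rho (rho i) \<le> 0)"

text \<open>The value is \<open>\<infinity>\<close> if the model is infeasible.\<close>

definition opt_value_star :: "('r, 'n) vp_data \<Rightarrow> ereal" where
  "opt_value_star M = (INF (rho, v) \<in> {(rho, v). feasible_star M rho v}. ereal (objective M v))"

text \<open>\<open>K i\<close> is the number of cells at \<open>i\<close>; the cells are indexed by \<open>{1..K i}\<close> and cell \<open>k\<close> is the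
  interval from \<open>g i k\<close> to \<open>g i (k + 1)\<close>.\<close>

definition discretization :: "('r, 'n) vp_data \<Rightarrow> ('n \<Rightarrow> nat) \<Rightarrow> ('n \<Rightarrow> nat \<Rightarrow> real) \<Rightarrow> bool" where
  "discretization M K g \<longleftrightarrow>
     (\<forall>i\<in>vertiports M. g i 1 = 0 \<and> g i (K i + 1) = 1 \<and> (\<forall>k\<in>{1..K i}. g i k < g i (k + 1)))"

text \<open>In the last cell the denominator vanishes; by convention the summand is then \<open>0\<close> or \<open>\<infinity>\<close>.\<close>

definition chord_term ::
  "('n \<Rightarrow> nat) \<Rightarrow> ('n \<Rightarrow> nat \<Rightarrow> real) \<Rightarrow> ('r, 'n) relaxed_vars \<Rightarrow> 'n \<Rightarrow> nat \<Rightarrow> ereal" where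
  "chord_term K g w i k =
     (if k = K i then (if vbeta w i k = 0 then 0 else \<infinity>)
      else ereal ((vpi w i k - g i k * g i (k + 1) * vbeta w i k)
                  / ((1 - g i k) * (1 - g i (k + 1)))))"

definition feasible_relaxed ::
  "('r, 'n) vp_data \<Rightarrow> ('n \<Rightarrow> nat) \<Rightarrow> ('n \<Rightarrow> nat \<Rightarrow> real) \<Rightarrow> ('n \<Rightarrow> real) \<Rightarrow>
   ('r, 'n) relaxed_vars \<Rightarrow> bool" where
  "feasible_relaxed M K g rho w \<longleftrightarrow>
     var_domains M rho w \<and> linear_constraints M rho w \<and>
     (\<forall>i\<in>vertiports M. 0 \<le> vTheta w i \<and>
        (\<forall>k\<in>{1..K i}. 0 \<le> vpi w i k \<and> vbeta w i k \<in> {0, 1})) \<and>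
     (\<forall>i\<in>vertiports M. \<forall>k\<in>{1..K i}. vTheta w i \<ge> (rho i - (g i k)\<^sup>2) / (1 - g i k)\<^sup>2) \<and>
     (\<Sum>i\<in>vertiports M. vTheta w i)
       + (\<Sum>i\<in>vertiports M. \<Sum>j\<in>vertiports M. tf M i j * (vpsi w i j + vphi w i j))
       \<le> real_of_int (vGamma w) \<and>
     (\<forall>i\<in>vertiports M.
        ereal (bfly M / bchg M * (\<Sum>j\<in>vertiports M. tf M i j * (vpsi w i j + vphi w i j)))
          - (\<Sum>k\<in>{1..K i}. chord_term K g w i k) \<le> 0) \<and>
     (\<forall>i\<in>vertiports M.
        (\<Sum>k\<in>{1..K i}. g i k * vbeta w i k) \<le> rho i \<and>
        rho i \<le> (\<Sum>k\<in>{1..K i}. g i (k + 1) * vbeta w i k) \<and>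
        (\<Sum>k\<in>{1..K i}. vbeta w i k) = 1) \<and>
     (\<forall>i\<in>vertiports M. \<forall>k\<in>{1..K i}.
        rho i - (1 - vbeta w i k) \<le> vpi w i k \<and> vpi w i k \<le> rho i \<and> vpi w i k \<le> vbeta w i k)"

definition optimal_relaxed ::
  "('r, 'n) vp_data \<Rightarrow> ('n \<Rightarrow> nat) \<Rightarrow> ('n \<Rightarrow> nat \<Rightarrow> real) \<Rightarrow> ('n \<Rightarrow> real) \<Rightarrow>
   ('r, 'n) relaxed_vars \<Rightarrow> bool" where
  "optimal_relaxed M K g rho w \<longleftrightarrow>
     feasible_relaxed M K g rho w \<and>
     (\<forall>rho' w'. feasible_relaxed M K g rho' w' \<longrightarrow> objective M w \<le> objective M w')"

text \<open>The relaxed solution selects the last cell at some \<open>i\<close>, so that its charging constraint at \<open>i\<close>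
  is vacuous, while \<open>k i\<close> names another cell. If both cells contain \<open>\<rho>\<^sub>i\<close>, this means that \<open>\<rho>\<^sub>i\<close>
  is exactly the last interior grid point. The width of cell \<open>k i\<close> then says nothing about the
  quality of the relaxation at \<open>i\<close>, and no bound independent of the grid can exist.\<close>

definition last_cell_tie ::
  "('r, 'n) vp_data \<Rightarrow> ('n \<Rightarrow> nat) \<Rightarrow> ('r, 'n) relaxed_vars \<Rightarrow> ('n \<Rightarrow> nat) \<Rightarrow> bool" where
  "last_cell_tie M K w k \<longleftrightarrow> (\<exists>i\<in>vertiports M. vbeta w i (K i) = 1 \<and> k i \<noteq> K i)"

end

theory Submission
  imports Defs
begin

text \<open>
  Keep every variable of the relaxed solution except the flows \<open>\<phi>\<close>. For fixed \<open>\<rho>\<close> the relaxed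
  constraints differ from the exact ones only by the errors of tangents and chords of \<open>f\<close>, which
  vanish with the width of the cells, so \<open>\<phi>\<close> satisfies the exact linear system up to a small
  perturbation \<open>t\<close> of its right-hand sides. Only finitely many such systems occur, since \<open>\<alpha>\<close>, and
  with it \<open>\<psi>\<close>, is determined by the binary \<open>y\<close>, and \<open>\<Gamma>\<close> is a bounded integer. By
  Fourier-Motzkin elimination, a linear system that is infeasible for \<open>t = 0\<close> stays infeasible for
  small \<open>t > 0\<close>; adding a cost bound to the system, one sees that a solution for small \<open>t\<close> can be
  replaced by an exact one at an extra cost of at most \<open>\<epsilon>\<close>. The last cell cannot contain \<open>\<rho>\<^sub>i\<close> once it
  is narrow, because its tangent would force \<open>\<Gamma>\<close> above the total capacity.
\<close>

section \<open>Affine forms and polyhedral systems with a perturbation parameter\<close>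

text \<open>Besides the unknowns \<open>x v\<close>, a form depends on a scalar \<open>t\<close>,
  the perturbation of the right-hand sides. The closure rules below reduce polyhedrality of a
  concrete system to introduction steps.\<close>

definition affine_form :: "'v set \<Rightarrow> (('v \<Rightarrow> real) \<Rightarrow> real \<Rightarrow> real) \<Rightarrow> bool" where
  "affine_form V L \<longleftrightarrow> (\<exists>a b c. \<forall>x t. L x t = (\<Sum>v\<in>V. a v * x v) + b + c * t)"

text \<open>The coefficients \<open>a\<close> of the unknowns do not depend on \<open>t\<close>.
  This keeps the system affine in \<open>t\<close> when inequalities are scaled by such coefficients
  and added during elimination.\<close>

definition polyhedral :: "'v set \<Rightarrow> (('v \<Rightarrow> real) \<Rightarrow> real \<Rightarrow> bool) \<Rightarrow> bool" where
  "polyhedral V P \<longleftrightarrow>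
     (\<exists>C. finite C \<and> (\<forall>x t. P x t \<longleftrightarrow> (\<forall>(a, b, c)\<in>C. (\<Sum>v\<in>V. a v * x v) + b + c * t \<le> 0)))"

lemma affine_form_param: "affine_form V (\<lambda>x t. t)"
  unfolding affine_form_def
  by (rule exI[of _ "\<lambda>_. 0"], rule exI[of _ 0], rule exI[of _ 1]) simp

lemma affine_form_const: "affine_form V (\<lambda>x t. b)"
  unfolding affine_form_def
  by (rule exI[of _ "\<lambda>_. 0"], rule exI[of _ b], rule exI[of _ 0]) simp

lemma affine_form_coord:
  assumes "finite V" "v \<in> V"
  shows "affine_form V (\<lambda>x t. x v)"
  unfolding affine_form_def
proof (intro exI allI)
  fix x :: "'a \<Rightarrow> real" and t :: real
  have "(\<Sum>u\<in>V. of_bool (u = v) * x u) = (\<Sum>u\<in>V. if v = u then x u else 0)"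
    by (rule sum.cong) auto
  then show "x v = (\<Sum>u\<in>V. of_bool (u = v) * x u) + 0 + 0 * t"
    using assms by simp
qed

lemma affine_form_add:
  assumes "affine_form V L" "affine_form V L'"
  shows "affine_form V (\<lambda>x t. L x t + L' x t)"
proof -
  obtain a b c a' b' c' where
    "\<And>x t. L x t = (\<Sum>v\<in>V. a v * x v) + b + c * t"
    "\<And>x t. L' x t = (\<Sum>v\<in>V. a' v * x v) + b' + c' * t"
    using assms unfolding affine_form_def by metis
  then have "L x t + L' x t = (\<Sum>v\<in>V. (a v + a' v) * x v) + (b + b') + (c + c') * t" for x t
    by (simp add: sum.distrib algebra_simps)
  then show ?thesis
    unfolding affine_form_def by (intro exI[of _ "\<lambda>v. a v + a' v"]) blast
qed

lemma affine_form_cmult: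
  assumes "affine_form V L"
  shows "affine_form V (\<lambda>x t. k * L x t)"
proof -
  obtain a b c where "\<And>x t. L x t = (\<Sum>v\<in>V. a v * x v) + b + c * t"
    using assms unfolding affine_form_def by metis
  then have "k * L x t = (\<Sum>v\<in>V. (k * a v) * x v) + k * b + (k * c) * t" for x t
    by (simp add: sum_distrib_left algebra_simps)
  then show ?thesis
    unfolding affine_form_def by (intro exI[of _ "\<lambda>v. k * a v"]) blast
qed

lemma affine_form_diff:
  assumes "affine_form V L" "affine_form V L'"
  shows "affine_form V (\<lambda>x t. L x t - L' x t)"
  using affine_form_add[OF assms(1) affine_form_cmult[OF assms(2), of "-1"]] by simp

lemma affine_form_sum:
  assumes "\<And>i. i \<in> I \<Longrightarrow> affine_form V (L i)"
  shows "affine_form V (\<lambda>x t. \<Sum>i\<in>I. L i x t)"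
  using assms
proof (induction I rule: infinite_finite_induct)
  case (insert i I)
  then show ?case
    using affine_form_add[of V "L i"] by simp
qed (simp_all add: affine_form_const)

lemma polyhedral_conj:
  assumes "polyhedral V P" "polyhedral V Q"
  shows "polyhedral V (\<lambda>x t. P x t \<and> Q x t)"
proof -
  obtain C where C: "finite C"
    "\<And>x t. P x t \<longleftrightarrow> (\<forall>(a, b, c)\<in>C. (\<Sum>v\<in>V. a v * x v) + b + c * t \<le> 0)"
    using assms(1) unfolding polyhedral_def by blast
  obtain D where D: "finite D"
    "\<And>x t. Q x t \<longleftrightarrow> (\<forall>(a, b, c)\<in>D. (\<Sum>v\<in>V. a v * x v) + b + c * t \<le> 0)"
    using assms(2) unfolding polyhedral_def by blast
  show ?thesis
    unfolding polyhedral_def by (intro exI[of _ "C \<union> D"]) (use C D in \<open>simp add: ball_Un\<close>)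
qed

lemma polyhedral_le:
  assumes "affine_form V L" "affine_form V L'"
  shows "polyhedral V (\<lambda>x t. L x t \<le> L' x t)"
proof -
  obtain a b c where "\<And>x t. L x t - L' x t = (\<Sum>v\<in>V. a v * x v) + b + c * t"
    using affine_form_diff[OF assms] unfolding affine_form_def by metis
  then have "L x t \<le> L' x t \<longleftrightarrow> (\<Sum>v\<in>V. a v * x v) + b + c * t \<le> 0" for x t
    by (metis diff_le_0_iff_le)
  then show ?thesis
    unfolding polyhedral_def by (intro exI[of _ "{(a, b, c)}"]) simp
qed

lemma polyhedral_eq:
  assumes "affine_form V L" "affine_form V L'"
  shows "polyhedral V (\<lambda>x t. L x t = L' x t)"
  unfolding order_eq_iff
  by (rule polyhedral_conj[OF polyhedral_le[OF assms] polyhedral_le[OF assms(2,1)]])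

lemma polyhedral_ball:
  assumes "finite I" "\<And>i. i \<in> I \<Longrightarrow> polyhedral V (P i)"
  shows "polyhedral V (\<lambda>x t. \<forall>i\<in>I. P i x t)"
  using assms
proof (induction I)
  case empty
  then show ?case
    unfolding polyhedral_def by (intro exI[of _ "{}"]) simp
next
  case (insert i I)
  then show ?case
    using polyhedral_conj[of V "P i"] by simp
qed

section \<open>Fourier-Motzkin elimination\<close>

text \<open>One elimination step, with \<open>t\<close> as the unknown. A positive
  \<open>p c\<close> makes \<open>c\<close> an upper bound on \<open>t\<close>, a negative one a
  lower bound; a solution exists iff no lower bound exceeds an upper bound. Cross-multiplication
  avoids division, so the conditions are linear in the terms \<open>l c\<close>.\<close>

lemma ex_linear_ineqs_iff:
  fixes p l :: "'c \<Rightarrow> real"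
  assumes "finite C"
  shows "(\<exists>t. \<forall>c\<in>C. p c * t + l c \<le> 0) \<longleftrightarrow>
         (\<forall>c\<in>{c \<in> C. p c = 0}. l c \<le> 0) \<and>
         (\<forall>c\<in>{c \<in> C. p c > 0}. \<forall>d\<in>{d \<in> C. p d < 0}. p c * l d - p d * l c \<le> 0)"
    (is "?L \<longleftrightarrow> ?Z \<and> ?R")
proof
  assume ?L
  then obtain t where t: "\<And>c. c \<in> C \<Longrightarrow> p c * t + l c \<le> 0" by blast
  have "l c \<le> 0" if "c \<in> C" "p c = 0" for c
    using t[OF that(1)] that(2) by simp
  moreover have "p c * l d - p d * l c \<le> 0"
    if "c \<in> C" "d \<in> C" "p c > 0" "p d < 0" for c d
  proof -
    \<comment> \<open>Each inequality is weighted by the absolute value of the other's coefficient,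
      so that \<open>t\<close> cancels in the sum.\<close>
    have "p c * (p d * t + l d) \<le> 0"
      using that t by (intro mult_nonneg_nonpos) auto
    moreover have "(- p d) * (p c * t + l c) \<le> 0"
      using that t by (intro mult_nonneg_nonpos) auto
    ultimately show ?thesis by (simp add: algebra_simps)
  qed
  ultimately show "?Z \<and> ?R" by blast
next
  assume ZR: "?Z \<and> ?R"
  define U where "U = (\<lambda>c. - l c / p c) ` {c \<in> C. p c > 0}"
  define W where "W = (\<lambda>c. - l c / p c) ` {c \<in> C. p c < 0}"
  have fin: "finite U" "finite W"
    unfolding U_def W_def using assms by auto
  have WU: "w \<le> u" if "w \<in> W" "u \<in> U" for w u
  proof -
    from \<open>u \<in> U\<close> obtain c where c: "c \<in> C" "p c > 0" "u = - l c / p c"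
      unfolding U_def by blast
    from \<open>w \<in> W\<close> obtain d where d: "d \<in> C" "p d < 0" "w = - l d / p d"
      unfolding W_def by blast
    have "p c * l d - p d * l c \<le> 0" using ZR c d by blast
    then show ?thesis
      using c(2) d(2) unfolding c(3) d(3)
      by (simp add: pos_divide_le_eq neg_le_divide_eq pos_le_divide_eq mult.commute)
  qed
  \<comment> \<open>The largest lower bound serves as \<open>t\<close>. Without lower bounds the
    least upper bound does; if \<open>U\<close> is empty too, \<open>Min U\<close> is unspecified
    but nothing constrains it.\<close>
  obtain t where t: "\<And>w. w \<in> W \<Longrightarrow> w \<le> t" "\<And>u. u \<in> U \<Longrightarrow> t \<le> u"
  proof (cases "W = {}")
    case True
    then show thesis using that[of "Min U"] fin by simp
  next
    case False
    then have "Max W \<in> W" using fin by simp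
    then show thesis using that[of "Max W"] fin WU by simp
  qed
  have "p c * t + l c \<le> 0" if "c \<in> C" for c
  proof (cases "p c" "0 :: real" rule: linorder_cases)
    case less
    then have "- l c / p c \<le> t" using that by (intro t(1)) (auto simp: W_def)
    then show ?thesis using less by (simp add: field_simps)
  next
    case equal
    then show ?thesis using ZR that by simp
  next
    case greater
    then have "t \<le> - l c / p c" using that by (intro t(2)) (auto simp: U_def)
    then show ?thesis using greater by (simp add: field_simps)
  qed
  then show ?L by blast
qed

text \<open>The elimination step combines pairs of inequalities with the fixed weights
  \<open>fst q u\<close> and \<open>- fst r u\<close>. The result is again finite, and affine in the
  remaining unknowns and in \<open>t\<close>.\<close>

lemma polyhedral_eliminate:
  assumes "finite V" "u \<notin> V" "polyhedral (insert u V) P"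
  shows "polyhedral V (\<lambda>x t. \<exists>s. P (x(u := s)) t)"
proof -
  obtain C where C: "finite C"
    "\<And>x t. P x t \<longleftrightarrow> (\<forall>(a, b, c)\<in>C. (\<Sum>v\<in>insert u V. a v * x v) + b + c * t \<le> 0)"
    using assms(3) unfolding polyhedral_def by blast
  \<comment> \<open>\<open>fst q u\<close> is the coefficient of the eliminated unknown in
    \<open>q\<close>; \<open>L q\<close> is the rest of that inequality, including its
    \<open>t\<close>-term.\<close>
  define L :: "('a \<Rightarrow> real) \<times> real \<times> real \<Rightarrow> ('a \<Rightarrow> real) \<Rightarrow> real \<Rightarrow> real"
    where "L = (\<lambda>(a, b, c) x t. (\<Sum>v\<in>V. a v * x v) + b + c * t)"
  have L: "affine_form V (L q)" for q
    unfolding affine_form_def L_def by (cases q) auto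
  have "P (x(u := s)) t \<longleftrightarrow> (\<forall>q\<in>C. fst q u * s + L q x t \<le> 0)" for x s t
  proof -
    have "(\<Sum>v\<in>V. a v * (x(u := s)) v) = (\<Sum>v\<in>V. a v * x v)" for a
      using assms(2) by (intro sum.cong) auto
    then show ?thesis
      using assms(1,2) unfolding C(2) L_def by (simp add: case_prod_beta add.assoc)
  qed
  then have eliminated:
    "(\<exists>s. P (x(u := s)) t) \<longleftrightarrow> (\<forall>q\<in>{q \<in> C. fst q u = 0}. L q x t \<le> 0) \<and>
      (\<forall>q\<in>{q \<in> C. fst q u > 0}. \<forall>r\<in>{r \<in> C. fst r u < 0}.
         fst q u * L r x t - fst r u * L q x t \<le> 0)" for x t
    by (simp only: ex_linear_ineqs_iff[OF C(1)])
  have fin: "finite {q \<in> C. R q}" for R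
    using C(1) by simp
  show ?thesis
    unfolding eliminated
    by (intro polyhedral_conj polyhedral_ball polyhedral_le affine_form_diff affine_form_cmult
        affine_form_const L fin)
qed

section \<open>Stability under small perturbations\<close>

text \<open>Eliminating all unknowns leaves finitely many conditions
  \<open>b + c * t \<le> 0\<close>. Infeasibility at \<open>t = 0\<close> exhibits one with
  \<open>b > 0\<close>, which remains violated for small \<open>t\<close>. The induction generalises
  over \<open>P\<close> because each elimination changes the system.\<close>

lemma polyhedral_infeasible_stable:
  assumes "finite V" "polyhedral V P" "\<nexists>x. P x 0"
  shows "\<forall>\<^sub>F t in at_right 0. \<nexists>x. P x t"
  using assms
proof (induction V arbitrary: P)
  case empty
  obtain C where C:
    "\<forall>x t. P x t \<longleftrightarrow> (\<forall>(a, b, c)\<in>C. (\<Sum>v\<in>{}. a v * x v) + b + c * t \<le> 0)"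
    using empty(1) unfolding polyhedral_def by blast
  then have "\<not> (\<forall>(a, b, c)\<in>C. b \<le> 0)"
    using empty(2) by simp
  then obtain a b c where q: "(a, b, c) \<in> C" "b > 0"
    by fastforce
  have "((\<lambda>t. b + c * t) \<longlongrightarrow> b + c * 0) (at_right 0)"
    by (intro tendsto_intros)
  then have "\<forall>\<^sub>F t in at_right 0. b + c * t > 0"
    using q(2) by (intro order_tendstoD(1)) auto
  then show ?case
  proof eventually_elim
    case (elim t)
    then have "\<not> (\<forall>(a, b, c)\<in>C. b + c * t \<le> 0)"
      using q(1) by fastforce
    then show ?case using C by simp
  qed
next
  case (insert u V)
  have "\<forall>\<^sub>F t in at_right 0. \<nexists>x. \<exists>s. P (x(u := s)) t"
    using insert.prems(2)
    by (intro insert.IH polyhedral_eliminate insert.hyps insert.prems(1)) blast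
  then show ?case
  proof eventually_elim
    case (elim t)
    have "\<not> P x t" for x
    proof
      assume "P x t"
      then have "P (x(u := x u)) t" by simp
      then show False using elim by blast
    qed
    then show ?case by blast
  qed
qed

text \<open>Let \<open>m\<close> be the infimum of \<open>c\<close> at \<open>t = 0\<close>. Adding
  the constraint \<open>c x \<le> m - e / 2\<close> makes the system infeasible at 0, hence also for
  small \<open>t\<close>. So perturbed points cost more than \<open>m - e / 2\<close>, while some
  exact point costs less than \<open>m + e / 2\<close>.\<close>

lemma polyhedral_near_optimal:
  fixes c :: "('v \<Rightarrow> real) \<Rightarrow> real"
  assumes "finite V" "polyhedral V P" "affine_form V (\<lambda>x t. c x)"
    and bdd: "bdd_below (c ` {x. P x 0})" and "e > 0"
  shows "\<forall>\<^sub>F t in at_right 0. \<forall>x. P x t \<longrightarrow> (\<exists>x'. P x' 0 \<and> c x' \<le> c x + e)"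
proof (cases "\<exists>x. P x 0")
  case False
  show ?thesis
    using polyhedral_infeasible_stable[OF assms(1,2) False] by eventually_elim blast
next
  case True
  define m where "m = Inf (c ` {x. P x 0})"
  have m: "m \<le> c x" if "P x 0" for x
    unfolding m_def using that bdd by (intro cInf_lower) auto
  have "\<exists>y\<in>c ` {x. P x 0}. y < m + e / 2"
    unfolding m_def using True \<open>e > 0\<close> by (intro cInf_lessD) auto
  then obtain x' where x': "P x' 0" "c x' < m + e / 2" by blast
  have "polyhedral V (\<lambda>x t. P x t \<and> c x \<le> m - e / 2)"
    by (intro polyhedral_conj polyhedral_le affine_form_const assms)
  moreover have "\<nexists>x. P x 0 \<and> c x \<le> m - e / 2"
    using m \<open>e > 0\<close> by force
  ultimately have "\<forall>\<^sub>F t in at_right 0. \<nexists>x. P x t \<and> c x \<le> m - e / 2"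
    by (rule polyhedral_infeasible_stable[OF assms(1)])
  then show ?thesis
  proof eventually_elim
    case (elim t)
    have "c x' \<le> c x + e" if "P x t" for x
      using elim that x'(2) by force
    then show ?case using x'(1) by blast
  qed
qed

section \<open>The flow system for fixed \<open>rho\<close>, \<open>psi\<close> and
  \<open>G\<close>\<close>

text \<open>With \<open>rho\<close> fixed, each \<open>f_rho (rho i)\<close> is a constant, so the
  constraints of [M^*] that involve the flows \<phi> are linear in them. The parameter
  \<open>t\<close> loosens only (F) and (C). Flows are indexed by pairs because a polyhedral system
  has a single index set of unknowns.\<close>

definition phi_feasible ::
  "('r, 'n) vp_data \<Rightarrow> ('n \<Rightarrow> real) \<Rightarrow> ('n \<Rightarrow> 'n \<Rightarrow> real) \<Rightarrow> int \<Rightarrow> ('n \<times> 'n \<Rightarrow> real) \<Rightarrow> real \<Rightarrow> bool"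
  where
  "phi_feasible M rho psi G x t \<longleftrightarrow>
     (\<forall>i\<in>vertiports M. \<forall>j\<in>vertiports M. 0 \<le> x (i, j)) \<and>
     (\<forall>i\<in>vertiports M. (\<Sum>j\<in>vertiports M. psi j i + x (j, i))
                        = (\<Sum>j\<in>vertiports M. psi i j + x (i, j))) \<and>
     (\<Sum>i\<in>vertiports M. f_rho (rho i))
       + (\<Sum>i\<in>vertiports M. \<Sum>j\<in>vertiports M. tf M i j * (psi i j + x (i, j)))
       \<le> real_of_int G + t \<and>
     (\<forall>i\<in>vertiports M.
        bfly M / bchg M * (\<Sum>j\<in>vertiports M. tf M i j * (psi i j + x (i, j)))
          \<le> f_rho (rho i) + t)"

definition phi_cost :: "('r, 'n) vp_data \<Rightarrow> ('n \<times> 'n \<Rightarrow> real) \<Rightarrow> real" where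
  "phi_cost M x = (\<Sum>i\<in>vertiports M. \<Sum>j\<in>vertiports M. pF M i j * x (i, j))"

lemma polyhedral_phi_feasible:
  assumes "finite (vertiports M)"
  shows "polyhedral (vertiports M \<times> vertiports M) (phi_feasible M rho psi G)"
proof -
  have "polyhedral (vertiports M \<times> vertiports M) (\<lambda>x t. phi_feasible M rho psi G x t)"
    unfolding phi_feasible_def
    by (intro polyhedral_conj polyhedral_ball polyhedral_le polyhedral_eq
        affine_form_const affine_form_param affine_form_sum affine_form_cmult affine_form_add
        affine_form_coord)
       (use assms in auto)
  then show ?thesis .
qed

lemma phi_feasible_cong:
  assumes "\<And>i j. i \<in> vertiports M \<Longrightarrow> j \<in> vertiports M \<Longrightarrow> psi i j = psi' i j"
  shows "phi_feasible M rho psi G x t = phi_feasible M rho psi' G x t"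
  unfolding phi_feasible_def using assms by (simp cong: sum.cong)

lemma phi_feasible_near_optimal:
  assumes "valid_data M" "e > 0"
  shows "\<forall>\<^sub>F t in at_right 0. \<forall>x. phi_feasible M rho psi G x t \<longrightarrow>
           (\<exists>x'. phi_feasible M rho psi G x' 0 \<and> phi_cost M x' \<le> phi_cost M x + e)"
proof (rule polyhedral_near_optimal)
  show "finite (vertiports M \<times> vertiports M)"
    using assms by (simp add: valid_data_def)
  show "polyhedral (vertiports M \<times> vertiports M) (phi_feasible M rho psi G)"
    using assms by (intro polyhedral_phi_feasible) (simp add: valid_data_def)
  show "affine_form (vertiports M \<times> vertiports M) (\<lambda>x t. phi_cost M x)"
    unfolding phi_cost_def
    by (intro affine_form_sum affine_form_cmult affine_form_coord)
       (use assms in \<open>auto simp: valid_data_def\<close>)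
  show "bdd_below (phi_cost M ` {x. phi_feasible M rho psi G x 0})"
  proof (rule bdd_belowI2)
    fix x assume "x \<in> {x. phi_feasible M rho psi G x 0}"
    then show "0 \<le> phi_cost M x"
      using assms(1) unfolding phi_cost_def phi_feasible_def valid_data_def
      by (auto intro!: sum_nonneg mult_nonneg_nonneg)
  qed
qed (rule assms)

section \<open>Finitely many flow systems\<close>

text \<open>\<open>Y\<close> stands for the set of indices with \<open>y = 1\<close>; the
  conditional is the value that \<alpha> is then forced to take.\<close>

definition psi_of ::
  "('r, 'n) vp_data \<Rightarrow> ('n \<Rightarrow> real) \<Rightarrow> ('r \<times> 'n \<times> 'n \<times> 'r) set \<Rightarrow> 'n \<Rightarrow> 'n \<Rightarrow> real" where
  "psi_of M rho Y i j =
     (\<Sum>o'\<in>demand_points M. \<Sum>d\<in>demand_points M.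
        demand M o' d / capQ M * (if (o', i, j, d) \<in> Y then rho i else 0))"

text \<open>The constraints on \<alpha> are the big-M linearisation of the product of
  \<open>rho i\<close> and \<open>y\<close>: for \<open>y = 1\<close> both bounds equal
  \<open>rho i\<close>, for \<open>y = 0\<close> both equal 0.\<close>

lemma vpsi_eq_psi_of:
  assumes "var_domains M rho v" "linear_constraints M rho v"
  shows "\<exists>Y\<subseteq>demand_points M \<times> vertiports M \<times> vertiports M \<times> demand_points M.
           \<forall>i\<in>vertiports M. \<forall>j\<in>vertiports M. vpsi v i j = psi_of M rho Y i j"
proof (intro exI conjI ballI)
  let ?Y = "{(o', i, j, d) \<in> demand_points M \<times> vertiports M \<times> vertiports M \<times> demand_points M.
              vy v o' i j d = 1}"
  show "?Y \<subseteq> demand_points M \<times> vertiports M \<times> vertiports M \<times> demand_points M"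
    by auto
  fix i j assume ij: "i \<in> vertiports M" "j \<in> vertiports M"
  have "valpha v o' i j d = (if (o', i, j, d) \<in> ?Y then rho i else 0)"
    if "o' \<in> demand_points M" "d \<in> demand_points M" for o' d
  proof -
    have "vy v o' i j d \<in> {0, 1}" "0 \<le> valpha v o' i j d"
      using assms(1) ij that unfolding var_domains_def by auto
    moreover have "rho i - (1 - vy v o' i j d) \<le> valpha v o' i j d"
      "valpha v o' i j d \<le> rho i" "valpha v o' i j d \<le> vy v o' i j d"
      using assms(2) ij that unfolding linear_constraints_def by blast+
    ultimately show ?thesis using ij that by auto
  qed
  moreover have "vpsi v i j = (\<Sum>o'\<in>demand_points M. \<Sum>d\<in>demand_points M.
                        demand M o' d / capQ M * valpha v o' i j d)"
    using assms(2) ij unfolding linear_constraints_def by blast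
  ultimately show "vpsi v i j = psi_of M rho ?Y i j"
    unfolding psi_of_def by (simp cong: sum.cong)
qed

definition Gamma_bound :: "('r, 'n) vp_data \<Rightarrow> real" where
  "Gamma_bound M = (\<Sum>i\<in>vertiports M. \<Sum>h\<in>sizes M. real h)"

lemma Gamma_bound_nonneg: "0 \<le> Gamma_bound M"
  unfolding Gamma_bound_def by (intro sum_nonneg) simp

lemma vGamma_le:
  assumes "var_domains M rho v" "linear_constraints M rho v"
  shows "real_of_int (vGamma v) \<le> Gamma_bound M"
proof -
  have "real_of_int (vGamma v) \<le> (\<Sum>i\<in>vertiports M. \<Sum>h\<in>sizes M. real h * vz v i h)"
    using assms(2) unfolding linear_constraints_def by blast
  also have "\<dots> \<le> Gamma_bound M"
    unfolding Gamma_bound_def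
  proof (intro sum_mono)
    fix i h assume "i \<in> vertiports M" "h \<in> sizes M"
    then have "vz v i h \<in> {0, 1}"
      using assms(1) unfolding var_domains_def by blast
    then show "real h * vz v i h \<le> real h" by auto
  qed
  finally show ?thesis .
qed

text \<open>The threshold for \<open>t\<close> depends on the flow system, but for fixed
  \<open>rho\<close> the system is determined by a subset \<open>Y\<close> of a finite set and an
  integer \<Gamma> between 0 and the capacity bound. Finitely many thresholds have a common one,
  valid for all \<open>v\<close> at once.\<close>

lemma phi_feasible_repair:
  fixes M :: "('r, 'n) vp_data"
  assumes "valid_data M" "e > 0"
  shows "\<forall>\<^sub>F t in at_right 0. \<forall>(v :: ('r, 'n, 'e) vars_scheme) x.
           var_domains M rho v \<longrightarrow> linear_constraints M rho v \<longrightarrow> 0 \<le> vGamma v \<longrightarrow>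
           phi_feasible M rho (vpsi v) (vGamma v) x t \<longrightarrow>
           (\<exists>x'. phi_feasible M rho (vpsi v) (vGamma v) x' 0 \<and> phi_cost M x' \<le> phi_cost M x + e)"
proof -
  let ?Ys = "Pow (demand_points M \<times> vertiports M \<times> vertiports M \<times> demand_points M)"
  have "\<forall>\<^sub>F t in at_right 0. \<forall>Y\<in>?Ys. \<forall>G\<in>{0..\<lfloor>Gamma_bound M\<rfloor>}. \<forall>x.
          phi_feasible M rho (psi_of M rho Y) G x t \<longrightarrow>
          (\<exists>x'. phi_feasible M rho (psi_of M rho Y) G x' 0 \<and> phi_cost M x' \<le> phi_cost M x + e)"
  proof (intro eventually_ball_finite ballI)
    show "finite ?Ys"
      using assms(1) by (simp add: valid_data_def)
  qed (rule finite_atLeastAtMost_int phi_feasible_near_optimal[OF assms])+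
  then show ?thesis
  proof (rule eventually_mono, intro allI impI)
    fix t x and v :: "('r, 'n, 'e) vars_scheme"
    assume elim: "\<forall>Y\<in>?Ys. \<forall>G\<in>{0..\<lfloor>Gamma_bound M\<rfloor>}. \<forall>x.
          phi_feasible M rho (psi_of M rho Y) G x t \<longrightarrow>
          (\<exists>x'. phi_feasible M rho (psi_of M rho Y) G x' 0 \<and> phi_cost M x' \<le> phi_cost M x + e)"
    assume v: "var_domains M rho v" "linear_constraints M rho v" "0 \<le> vGamma v"
      and x: "phi_feasible M rho (vpsi v) (vGamma v) x t"
    obtain Y where
      Y: "Y \<subseteq> demand_points M \<times> vertiports M \<times> vertiports M \<times> demand_points M"
      "\<forall>i\<in>vertiports M. \<forall>j\<in>vertiports M. vpsi v i j = psi_of M rho Y i j"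
      using vpsi_eq_psi_of[OF v(1,2)] by blast
    have "Y \<in> ?Ys" using Y(1) by (rule PowI)
    have cong: "phi_feasible M rho (vpsi v) G x t = phi_feasible M rho (psi_of M rho Y) G x t" for G x t
      using Y(2) by (intro phi_feasible_cong) blast
    have "vGamma v \<in> {0..\<lfloor>Gamma_bound M\<rfloor>}"
      using vGamma_le[OF v(1,2)] v(3) by (simp add: le_floor_iff)
    then show "\<exists>x'. phi_feasible M rho (vpsi v) (vGamma v) x' 0 \<and> phi_cost M x' \<le> phi_cost M x + e"
      using elim[THEN bspec, OF \<open>Y \<in> ?Ys\<close>] x unfolding cong by blast
  qed
qed

section \<open>Errors of chords and tangents of \<open>f_rho\<close>\<close>

text \<open>The left-hand side is the chord of \<open>f_rho\<close> through the points at
  \<open>a\<close> and \<open>b\<close>. Its error is nonnegative between them and vanishes at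
  both.\<close>

lemma chord_eq:
  assumes "a < 1" "b < 1" "x < 1"
  shows "(x - a * b) / ((1 - a) * (1 - b)) =
         f_rho x + (x - a) * (b - x) / ((1 - a) * (1 - b) * (1 - x))"
proof -
  have "1 - a \<noteq> 0" "1 - b \<noteq> 0" "1 - x \<noteq> 0" using assms by auto
  then show ?thesis
    unfolding f_rho_def by (simp add: divide_simps) algebra
qed

text \<open>The left-hand side is the tangent of \<open>f_rho\<close> at \<open>a\<close>; the
  subtracted term is nonnegative, so the tangent lies below the function.\<close>

lemma tangent_eq:
  assumes "a < 1" "x < 1"
  shows "(x - a\<^sup>2) / (1 - a)\<^sup>2 = f_rho x - (x - a)\<^sup>2 / ((1 - a)\<^sup>2 * (1 - x))"
proof -
  have "1 - a \<noteq> 0" "1 - x \<noteq> 0" using assms by auto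
  then show ?thesis
    unfolding f_rho_def by (simp add: divide_simps) algebra
qed

text \<open>Since \<open>x\<close> is fixed, its distance \<open>m\<close> from the pole at 1 is
  fixed, and narrow cells around \<open>x\<close> stay away from the pole. Both errors are then of
  order \<open>w\<^sup>2 / m ^ 3\<close>, whatever \<open>a\<close> and \<open>b\<close> are. For
  \<open>x \<ge> 1\<close> no admissible \<open>b\<close> exists.\<close>

lemma chord_tangent_error:
  fixes x t :: real
  assumes "t > 0"
  shows "\<forall>\<^sub>F w in at_right 0. \<forall>a b. a \<le> x \<longrightarrow> x \<le> b \<longrightarrow> b < 1 \<longrightarrow> b - a \<le> w \<longrightarrow>
           (x - a * b) / ((1 - a) * (1 - b)) \<le> f_rho x + t \<and>
           f_rho x - t \<le> (x - a\<^sup>2) / (1 - a)\<^sup>2"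
proof (cases "x < 1")
  case False
  then show ?thesis by simp
next
  case True
  define m where "m = 1 - x"
  have m: "m > 0" using True by (simp add: m_def)
  have "((\<lambda>w. 2 * w\<^sup>2 / m ^ 3) \<longlongrightarrow> 2 * 0\<^sup>2 / m ^ 3) (at_right 0)"
    using m by (intro tendsto_intros) auto
  then have "\<forall>\<^sub>F w in at_right 0. 2 * w\<^sup>2 / m ^ 3 < t"
    using assms by (intro order_tendstoD(2)) auto
  moreover have "\<forall>\<^sub>F w in at_right 0. w < m / 2"
    using m by (intro eventually_at_rightI[of 0 "m / 2"]) auto
  ultimately show ?thesis
  proof (eventually_elim, intro allI impI)
    fix w a b
    assume w: "2 * w\<^sup>2 / m ^ 3 < t" "w < m / 2"
      and ab: "a \<le> x" "x \<le> b" "b < 1" "b - a \<le> w"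
    \<comment> \<open>Here \<open>1 - a \<ge> m\<close>, and \<open>1 - b \<ge> m / 2\<close>
      because \<open>b \<le> x + w\<close>.\<close>
    have "(x - a) * (b - x) / ((1 - a) * (1 - b) * (1 - x)) \<le> (w * w) / (m * (m / 2) * m)"
      using ab w m by (intro frac_le mult_mono mult_nonneg_nonneg mult_pos_pos) (auto simp: m_def)
    moreover have "(w * w) / (m * (m / 2) * m) = 2 * w\<^sup>2 / m ^ 3"
      by (simp add: power2_eq_square power3_eq_cube)
    \<comment> \<open>The factor 2 is slack, so that chord and tangent share one threshold.\<close>
    moreover have "(x - a)\<^sup>2 / ((1 - a)\<^sup>2 * (1 - x)) \<le> (2 * w\<^sup>2) / (m\<^sup>2 * m)"
    proof (intro frac_le mult_mono power_mono)
      have "(x - a)\<^sup>2 \<le> w\<^sup>2" using ab by (intro power_mono) auto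
      then show "(x - a)\<^sup>2 \<le> 2 * w\<^sup>2" using zero_le_power2[of w] by linarith
    qed (use ab w m in \<open>auto simp: m_def\<close>)
    moreover have "(2 * w\<^sup>2) / (m\<^sup>2 * m) = 2 * w\<^sup>2 / m ^ 3"
      by (simp add: power2_eq_square power3_eq_cube)
    moreover have "a < 1" using ab by linarith
    ultimately show "(x - a * b) / ((1 - a) * (1 - b)) \<le> f_rho x + t \<and>
           f_rho x - t \<le> (x - a\<^sup>2) / (1 - a)\<^sup>2"
      using w(1) ab(3) True by (simp add: chord_eq tangent_eq)
  qed
qed

section \<open>Grid cells and binary selections\<close>

lemma discretization_less:
  assumes "discretization M K g" "i \<in> vertiports M" "1 \<le> j" "j < k" "k \<le> K i + 1"
  shows "g i j < g i k"
  using assms(4,5)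
proof (induction k)
  case (Suc k)
  have "g i k < g i (Suc k)" if "1 \<le> k"
    using assms(1,2) that Suc.prems unfolding discretization_def by auto
  then show ?case using Suc assms(3) by (cases "j = k") auto
qed simp

lemma discretization_less_1:
  assumes "discretization M K g" "i \<in> vertiports M" "1 \<le> j" "j \<le> K i"
  shows "g i j < 1"
proof -
  have "g i j < g i (K i + 1)" using assms by (intro discretization_less) auto
  then show ?thesis using assms(1,2) by (simp add: discretization_def)
qed

lemma discretization_cell:
  assumes "discretization M K g" "i \<in> vertiports M" "0 \<le> r" "r \<le> 1"
  obtains k where "k \<in> {1..K i}" "g i k \<le> r" "r \<le> g i (k + 1)"
proof -
  \<comment> \<open>The cell starts at the last of the points \<open>g i 1\<close>, ...,
    \<open>g i (K i)\<close> that does not exceed \<open>r\<close>.\<close>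
  let ?A = "{k \<in> {1..K i}. g i k \<le> r}"
  have g: "g i 1 = 0" "g i (K i + 1) = 1"
    using assms(1,2) by (auto simp: discretization_def)
  \<comment> \<open>Without cells, \<open>g i 1\<close> would be both 0 and 1.\<close>
  then have "K i \<noteq> 0" by (metis add_0 zero_neq_one)
  then have "1 \<in> ?A" using g assms(3) by auto
  then have A: "finite ?A" "?A \<noteq> {}" by auto
  have k: "Max ?A \<in> ?A" by (rule Max_in[OF A])
  have "r \<le> g i (Max ?A + 1)"
  proof (cases "Max ?A = K i")
    case True
    then show ?thesis using g assms(4) by simp
  next
    case False
    have "Max ?A + 1 \<notin> ?A" using Max_ge[OF A(1), of "Max ?A + 1"] by linarith
    then show ?thesis using False k by auto
  qed
  then show thesis using that k by blast
qed

lemma binary_sum_eq_1: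
  fixes b :: "'k \<Rightarrow> real"
  assumes "finite A" "\<And>k. k \<in> A \<Longrightarrow> b k \<in> {0, 1}" "sum b A = 1"
  obtains k where "k \<in> A" "b k = 1" "\<And>l. l \<in> A \<Longrightarrow> l \<noteq> k \<Longrightarrow> b l = 0"
proof -
  obtain k where k: "k \<in> A" "b k \<noteq> 0"
    using assms(3) by (metis sum.neutral zero_neq_one)
  then have "b k = 1" using assms(2) by blast
  moreover have "sum b (A - {k}) = 0"
    using assms(1,3) k(1) calculation by (simp add: sum_diff1)
  then have "\<forall>l\<in>A - {k}. b l = 0"
    using assms(1,2) by (subst (asm) sum_nonneg_eq_0_iff) fastforce+
  ultimately show thesis using that k(1) by blast
qed

lemma sum_indicator_mult:
  fixes h :: "'k \<Rightarrow> real"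
  assumes "finite A" "a \<in> A"
  shows "(\<Sum>l\<in>A. h l * (if l = a then 1 else 0)) = h a"
proof -
  have "(\<Sum>l\<in>A. h l * (if l = a then 1 else 0)) = (\<Sum>l\<in>A. if a = l then h l else 0)"
    by (rule sum.cong) auto
  then show ?thesis using assms by simp
qed

section \<open>The relaxed model as a lower bound\<close>

text \<open>By convexity of \<open>f_rho\<close> on values below 1, tangents underestimate it and
  the chord over a cell overestimates it on that cell. So the exact point satisfies the relaxed
  constraints once the auxiliary variables are added.\<close>

lemma feasible_star_imp_feasible_relaxed:
  fixes v :: "('r, 'n) vars"
  assumes disc: "discretization M K g" and star: "feasible_star M rho v"
  shows "\<exists>w. feasible_relaxed M K g rho w \<and> objective M w = objective M v"
proof -
  have dom: "var_domains M rho v" and lin: "linear_constraints M rho v"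
    and rho1: "\<And>i. i \<in> vertiports M \<Longrightarrow> rho i < 1"
    and flt: "(\<Sum>i\<in>vertiports M. f_rho (rho i))
       + (\<Sum>i\<in>vertiports M. \<Sum>j\<in>vertiports M. tf M i j * (vpsi v i j + vphi v i j))
       \<le> real_of_int (vGamma v)"
    and chg: "\<And>i. i \<in> vertiports M \<Longrightarrow>
        bfly M / bchg M * (\<Sum>j\<in>vertiports M. tf M i j * (vpsi v i j + vphi v i j))
          - f_rho (rho i) \<le> 0"
    using star unfolding feasible_star_def by blast+
  have rho0: "0 \<le> rho i" if "i \<in> vertiports M" for i
    using dom that unfolding var_domains_def by blast
  have "\<forall>i\<in>vertiports M. \<exists>k. k \<in> {1..K i} \<and> g i k \<le> rho i \<and> rho i \<le> g i (k + 1)"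
  proof
    fix i assume i: "i \<in> vertiports M"
    show "\<exists>k. k \<in> {1..K i} \<and> g i k \<le> rho i \<and> rho i \<le> g i (k + 1)"
      by (rule discretization_cell[OF disc i rho0[OF i] less_imp_le[OF rho1[OF i]]]) blast
  qed
  then obtain k where
    "\<forall>i\<in>vertiports M. k i \<in> {1..K i} \<and> g i (k i) \<le> rho i \<and> rho i \<le> g i (k i + 1)"
    unfolding bchoice_iff by blast
  then have k: "k i \<in> {1..K i}" "g i (k i) \<le> rho i" "rho i \<le> g i (k i + 1)"
    if "i \<in> vertiports M" for i
    using that by blast+
  \<comment> \<open>\<open>vTheta\<close> takes the exact value of \<open>f_rho\<close>,
    \<open>vbeta\<close> is the indicator of the cell \<open>k i\<close>, and \<open>vpi\<close> is
    the product of \<open>rho i\<close> with it.\<close>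
  define w :: "('r, 'n) relaxed_vars" where
    "w = \<lparr>vx = vx v, vz = vz v, vy = vy v, vGamma = vGamma v, valpha = valpha v,
          vpsi = vpsi v, vphi = vphi v, vTheta = (\<lambda>i. f_rho (rho i)),
          vpi = (\<lambda>i l. if l = k i then rho i else 0),
          vbeta = (\<lambda>i l. if l = k i then 1 else 0)\<rparr>"
  have w: "vx w = vx v" "vz w = vz v" "vy w = vy v" "valpha w = valpha v"
    "vGamma w = vGamma v" "vpsi w = vpsi v" "vphi w = vphi v"
    "vTheta w = (\<lambda>i. f_rho (rho i))"
    "vpi w = (\<lambda>i l. if l = k i then rho i else 0)"
    "vbeta w = (\<lambda>i l. if l = k i then 1 else 0)"
    by (simp_all add: w_def)
  have "var_domains M rho w"
    using dom unfolding var_domains_def w .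
  moreover have "linear_constraints M rho w"
    using lin unfolding linear_constraints_def w .
  moreover have "\<forall>i\<in>vertiports M. 0 \<le> vTheta w i \<and>
        (\<forall>k\<in>{1..K i}. 0 \<le> vpi w i k \<and> vbeta w i k \<in> {0, 1})"
    using rho0 rho1 by (auto simp: w f_rho_def less_imp_le)
  moreover have "\<forall>i\<in>vertiports M. \<forall>k\<in>{1..K i}. vTheta w i \<ge> (rho i - (g i k)\<^sup>2) / (1 - g i k)\<^sup>2"
  proof (intro ballI)
    fix i l assume i: "i \<in> vertiports M" "l \<in> {1..K i}"
    then have "g i l < 1" using disc by (intro discretization_less_1[OF disc]) auto
    then have "(rho i - (g i l)\<^sup>2) / (1 - g i l)\<^sup>2 =
        f_rho (rho i) - (rho i - g i l)\<^sup>2 / ((1 - g i l)\<^sup>2 * (1 - rho i))"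
      using rho1[OF i(1)] by (intro tangent_eq)
    moreover have "0 \<le> (rho i - g i l)\<^sup>2 / ((1 - g i l)\<^sup>2 * (1 - rho i))"
      using rho1[OF i(1)] by simp
    ultimately show "(rho i - (g i l)\<^sup>2) / (1 - g i l)\<^sup>2 \<le> vTheta w i"
      unfolding w by linarith
  qed
  moreover have "(\<Sum>i\<in>vertiports M. vTheta w i)
       + (\<Sum>i\<in>vertiports M. \<Sum>j\<in>vertiports M. tf M i j * (vpsi w i j + vphi w i j))
       \<le> real_of_int (vGamma w)"
    using flt by (simp add: w)
  moreover have "\<forall>i\<in>vertiports M.
        ereal (bfly M / bchg M * (\<Sum>j\<in>vertiports M. tf M i j * (vpsi w i j + vphi w i j)))
          - (\<Sum>k\<in>{1..K i}. chord_term K g w i k) \<le> 0"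
  proof
    fix i assume i: "i \<in> vertiports M"
    let ?T = "bfly M / bchg M * (\<Sum>j\<in>vertiports M. tf M i j * (vpsi w i j + vphi w i j))"
    have "(\<Sum>l\<in>{1..K i}. chord_term K g w i l) =
        (\<Sum>l\<in>{1..K i}. if k i = l then chord_term K g w i l else 0)"
      by (rule sum.cong) (auto simp: chord_term_def w zero_ereal_def)
    then have chord: "(\<Sum>l\<in>{1..K i}. chord_term K g w i l) = chord_term K g w i (k i)"
      using k(1)[OF i] by simp
    show "ereal ?T - (\<Sum>k\<in>{1..K i}. chord_term K g w i k) \<le> 0"
    proof (cases "k i = K i")
      case True
      \<comment> \<open>The summand of the last cell is \<infinity>, so the constraint holds
        trivially.\<close>
      then show ?thesis unfolding chord by (simp add: chord_term_def w)
    next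
      case False
      let ?a = "g i (k i)" and ?b = "g i (k i + 1)"
      have ab: "?a < 1" "?b < 1"
        using disc i k(1)[OF i] False by (auto intro!: discretization_less_1[OF disc i])
      have "(rho i - ?a * ?b) / ((1 - ?a) * (1 - ?b)) =
          f_rho (rho i) + (rho i - ?a) * (?b - rho i) / ((1 - ?a) * (1 - ?b) * (1 - rho i))"
        using ab rho1[OF i] by (rule chord_eq)
      moreover have "0 \<le> (rho i - ?a) * (?b - rho i) / ((1 - ?a) * (1 - ?b) * (1 - rho i))"
        using ab rho1[OF i] k(2,3)[OF i] by (intro divide_nonneg_nonneg mult_nonneg_nonneg) auto
      ultimately have "?T \<le> (rho i - ?a * ?b) / ((1 - ?a) * (1 - ?b))"
        using chg[OF i] unfolding w by linarith
      moreover have "chord_term K g w i (k i) = ereal ((rho i - ?a * ?b) / ((1 - ?a) * (1 - ?b)))"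
        using False by (simp add: chord_term_def w)
      ultimately show ?thesis unfolding chord by (simp add: zero_ereal_def)
    qed
  qed
  moreover have "\<forall>i\<in>vertiports M.
        (\<Sum>k\<in>{1..K i}. g i k * vbeta w i k) \<le> rho i \<and>
        rho i \<le> (\<Sum>k\<in>{1..K i}. g i (k + 1) * vbeta w i k) \<and>
        (\<Sum>k\<in>{1..K i}. vbeta w i k) = 1"
  proof
    fix i assume i: "i \<in> vertiports M"
    have "(\<Sum>l\<in>{1..K i}. h l * vbeta w i l) = h (k i)" for h
      unfolding w using k(1)[OF i] by (intro sum_indicator_mult) auto
    from this[of "g i"] this[of "\<lambda>l. g i (l + 1)"] this[of "\<lambda>_. 1"]
    show "(\<Sum>k\<in>{1..K i}. g i k * vbeta w i k) \<le> rho i \<and>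
        rho i \<le> (\<Sum>k\<in>{1..K i}. g i (k + 1) * vbeta w i k) \<and>
        (\<Sum>k\<in>{1..K i}. vbeta w i k) = 1"
      using k(2,3)[OF i] by simp
  qed
  moreover have "\<forall>i\<in>vertiports M. \<forall>k\<in>{1..K i}.
        rho i - (1 - vbeta w i k) \<le> vpi w i k \<and> vpi w i k \<le> rho i \<and> vpi w i k \<le> vbeta w i k"
    using rho0 rho1 by (auto simp: w less_imp_le)
  ultimately have "feasible_relaxed M K g rho w"
    unfolding feasible_relaxed_def by blast
  moreover have "objective M w = objective M v"
    by (simp add: w_def objective_def)
  ultimately show ?thesis by blast
qed

lemma optimal_relaxed_le_opt_value_star:
  assumes "discretization M K g" "optimal_relaxed M K g rho w"
  shows "ereal (objective M w) \<le> opt_value_star M"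
  unfolding opt_value_star_def
proof (rule INF_greatest, clarify)
  fix rho' v assume "feasible_star M rho' v"
  then obtain w' where "feasible_relaxed M K g rho' w'" "objective M w' = objective M v"
    using feasible_star_imp_feasible_relaxed[OF assms(1)] by blast
  then show "ereal (objective M w) \<le> ereal (objective M v)"
    using assms(2) unfolding optimal_relaxed_def by (metis ereal_less_eq(3))
qed

section \<open>From relaxed solutions to the perturbed flow system\<close>

text \<open>If the selected cell \<open>l\<close> differs from \<open>k\<close>, then \<open>rho i\<close> is an endpoint of both, where the
  chord of \<open>l\<close> is exact; so the error is controlled by cell \<open>k\<close> whichever cell is selected.\<close>

lemma charging_bound:
  fixes w :: "('r, 'n) relaxed_vars"
  assumes disc: "discretization M K g" and feas: "feasible_relaxed M K g rho w"
    and i: "i \<in> vertiports M" and last: "vbeta w i (K i) \<noteq> 1"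
    and k: "k \<in> {1..K i}" "k \<noteq> K i" "g i k \<le> rho i" "rho i \<le> g i (k + 1)"
    and s: "0 \<le> s"
    and chord: "(rho i - g i k * g i (k + 1)) / ((1 - g i k) * (1 - g i (k + 1))) \<le> f_rho (rho i) + s"
  shows "bfly M / bchg M * (\<Sum>j\<in>vertiports M. tf M i j * (vpsi w i j + vphi w i j))
           \<le> f_rho (rho i) + s" (is "?T \<le> _")
proof -
  have beta: "\<And>l. l \<in> {1..K i} \<Longrightarrow> vbeta w i l \<in> {0, 1}"
    and beta_sum: "(\<Sum>l\<in>{1..K i}. vbeta w i l) = 1"
    and pi: "\<And>l. l \<in> {1..K i} \<Longrightarrow> 0 \<le> vpi w i l \<and> rho i - (1 - vbeta w i l) \<le> vpi w i l \<and>
               vpi w i l \<le> rho i \<and> vpi w i l \<le> vbeta w i l"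
    and cell: "(\<Sum>k\<in>{1..K i}. g i k * vbeta w i k) \<le> rho i"
      "rho i \<le> (\<Sum>k\<in>{1..K i}. g i (k + 1) * vbeta w i k)"
    and T: "ereal ?T - (\<Sum>k\<in>{1..K i}. chord_term K g w i k) \<le> 0"
    using feas i unfolding feasible_relaxed_def by blast+
  obtain l where l: "l \<in> {1..K i}" "vbeta w i l = 1"
    and others: "\<And>m. m \<in> {1..K i} \<Longrightarrow> m \<noteq> l \<Longrightarrow> vbeta w i m = 0"
    using binary_sum_eq_1[of "{1..K i}" "vbeta w i", OF finite_atLeastAtMost beta beta_sum] by metis
  have beta_eq: "vbeta w i m = (if m = l then 1 else 0)" if "m \<in> {1..K i}" for m
    using l(2) others[OF that] by simp
  have sums: "(\<Sum>m\<in>{1..K i}. h m * vbeta w i m) = h l" for h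
  proof -
    have "(\<Sum>m\<in>{1..K i}. h m * vbeta w i m) = (\<Sum>m\<in>{1..K i}. h m * (if m = l then 1 else 0))"
      using beta_eq by (intro sum.cong) auto
    then show ?thesis using l(1) by (simp only: sum_indicator_mult finite_atLeastAtMost)
  qed
  have lcell: "g i l \<le> rho i" "rho i \<le> g i (l + 1)"
    using cell sums[of "g i"] sums[of "\<lambda>m. g i (m + 1)"] by auto
  have lK: "l \<noteq> K i" using l(2) last by auto
  let ?a = "g i l" and ?b = "g i (l + 1)"
  have ab: "?a < 1" "?b < 1"
    using disc i l(1) lK by (auto intro!: discretization_less_1[OF disc i])
  then have rho1: "rho i < 1" using lcell by linarith
  have "vpi w i l = rho i" using pi[OF l(1)] l(2) by auto
  then have chord_l: "chord_term K g w i l = ereal ((rho i - ?a * ?b) / ((1 - ?a) * (1 - ?b)))"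
    using lK l(2) by (simp add: chord_term_def)
  have "chord_term K g w i m = 0" if m: "m \<in> {1..K i}" "m \<noteq> l" for m
  proof -
    have "vpi w i m = 0" using pi[OF m(1)] others[OF m] by auto
    then show ?thesis using others[OF m] by (auto simp: chord_term_def zero_ereal_def)
  qed
  then have "(\<Sum>m\<in>{1..K i}. chord_term K g w i m) =
      (\<Sum>m\<in>{1..K i}. if l = m then chord_term K g w i m else 0)"
    by (intro sum.cong) auto
  also have "\<dots> = chord_term K g w i l"
    using l(1) by simp
  finally have "?T \<le> (rho i - ?a * ?b) / ((1 - ?a) * (1 - ?b))"
    using T chord_l by (simp add: zero_ereal_def)
  also have "\<dots> \<le> f_rho (rho i) + s"
  proof (cases "l = k")
    case True
    then show ?thesis using chord by simp
  next
    case False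
    \<comment> \<open>Grid points increase strictly, so two distinct cells that share a point are
      adjacent and meet only in their common endpoint.\<close>
    have "rho i = ?a \<or> rho i = ?b"
    proof (cases "l < k")
      case True
      then have "l + 1 = k \<or> g i (l + 1) < g i k"
        using disc i l(1) k(1) by (cases "l + 1 = k") (auto intro!: discretization_less[OF disc i])
      then show ?thesis using k(3) lcell by auto
    next
      case False
      then have "k + 1 = l \<or> g i (k + 1) < g i l"
        using \<open>l \<noteq> k\<close> disc i l(1) k(1)
        by (cases "k + 1 = l") (auto intro!: discretization_less[OF disc i])
      then show ?thesis using k(4) lcell by auto
    qed
    then have exact: "(rho i - ?a) * (?b - rho i) = 0" by auto
    show ?thesis unfolding chord_eq[OF ab rho1] exact using s by simp
  qed
  finally show ?thesis .
qed

text \<open>The flow term of the fleet constraint is nonnegative. Together with the capacity bound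
  on \<Gamma> this bounds each \<open>vTheta w i\<close> independently of the grid.\<close>

lemma feasible_relaxed_sum_Theta_le:
  fixes w :: "('r, 'n) relaxed_vars"
  assumes valid: "valid_data M" and feas: "feasible_relaxed M K g rho w"
  shows "(\<Sum>i\<in>vertiports M. vTheta w i) \<le> real_of_int (vGamma w)"
proof -
  have dom: "var_domains M rho w"
    and flt: "(\<Sum>i\<in>vertiports M. vTheta w i)
       + (\<Sum>i\<in>vertiports M. \<Sum>j\<in>vertiports M. tf M i j * (vpsi w i j + vphi w i j))
       \<le> real_of_int (vGamma w)"
    using feas unfolding feasible_relaxed_def by blast+
  have "0 \<le> vpsi w i j" "0 \<le> vphi w i j" "0 \<le> tf M i j"
    if "i \<in> vertiports M" "j \<in> vertiports M" for i j
    using dom valid that unfolding var_domains_def valid_data_def by blast+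
  then have "0 \<le> (\<Sum>i\<in>vertiports M. \<Sum>j\<in>vertiports M. tf M i j * (vpsi w i j + vphi w i j))"
    by (intro sum_nonneg mult_nonneg_nonneg add_nonneg_nonneg)
  then show ?thesis using flt by linarith
qed

lemma feasible_relaxed_vGamma_nonneg:
  fixes w :: "('r, 'n) relaxed_vars"
  assumes "valid_data M" "feasible_relaxed M K g rho w"
  shows "0 \<le> vGamma w"
proof -
  have "0 \<le> (\<Sum>i\<in>vertiports M. vTheta w i)"
    using assms(2) unfolding feasible_relaxed_def by (intro sum_nonneg) blast
  then have "0 \<le> real_of_int (vGamma w)"
    using feasible_relaxed_sum_Theta_le[OF assms] by linarith
  then show ?thesis by simp
qed

text \<open>Tangent errors perturb (F) and chord errors perturb (C). As \<open>rho\<close> is fixed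
  beforehand, the admissible width \<open>e\<close> is uniform over all grids, relaxed solutions and
  choices of cells.\<close>

lemma feasible_relaxed_imp_phi_feasible:
  fixes M :: "('r, 'n) vp_data"
  assumes valid: "valid_data M" and "t > 0"
  shows "\<forall>\<^sub>F e in at_right 0. \<forall>K g (w :: ('r, 'n) relaxed_vars) k.
           discretization M K g \<longrightarrow> feasible_relaxed M K g rho w \<longrightarrow>
           (\<forall>i\<in>vertiports M. k i \<in> {1..K i} \<and> g i (k i) \<le> rho i \<and> rho i \<le> g i (k i + 1)) \<longrightarrow>
           \<not> last_cell_tie M K w k \<longrightarrow>
           (\<forall>i\<in>vertiports M. g i (k i + 1) - g i (k i) \<le> e) \<longrightarrow>
           (\<forall>i\<in>vertiports M. rho i < 1) \<and>
           phi_feasible M rho (vpsi w) (vGamma w) (\<lambda>(i, j). vphi w i j) t"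
proof -
  have finN: "finite (vertiports M)" using valid by (simp add: valid_data_def)
  \<comment> \<open>The tangent errors at all vertiports add up in (F), so each receives a share of
    \<open>t\<close>. The added 1 covers an empty set of vertiports and gives
    \<open>s \<le> t\<close>.\<close>
  define s where "s = t / (real (card (vertiports M)) + 1)"
  have s: "s > 0" "s \<le> t" "real (card (vertiports M)) * s \<le> t"
    using \<open>t > 0\<close> by (auto simp: s_def field_simps)
  let ?B = "Gamma_bound M"
  have B: "0 \<le> ?B" by (rule Gamma_bound_nonneg)
  have "\<forall>\<^sub>F e in at_right 0. \<forall>i\<in>vertiports M. \<forall>a b.
           a \<le> rho i \<longrightarrow> rho i \<le> b \<longrightarrow> b < 1 \<longrightarrow> b - a \<le> e \<longrightarrow>
           (rho i - a * b) / ((1 - a) * (1 - b)) \<le> f_rho (rho i) + s \<and>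
           f_rho (rho i) - s \<le> (rho i - a\<^sup>2) / (1 - a)\<^sup>2"
    by (intro eventually_ball_finite finN ballI chord_tangent_error s)
  \<comment> \<open>A last cell narrower than \<open>1 / (?B + 1)\<close> starts at a point where
    \<open>f_rho\<close> exceeds \<open>?B\<close>.\<close>
  moreover have "\<forall>\<^sub>F e in at_right 0. e < 1 / (?B + 1)"
    using B by (intro eventually_at_rightI[of 0 "1 / (?B + 1)"]) auto
  ultimately show ?thesis
  proof (rule eventually_elim2, intro allI impI)
    fix e K g k and w :: "('r, 'n) relaxed_vars"
    assume err: "\<forall>i\<in>vertiports M. \<forall>a b.
           a \<le> rho i \<longrightarrow> rho i \<le> b \<longrightarrow> b < 1 \<longrightarrow> b - a \<le> e \<longrightarrow>
           (rho i - a * b) / ((1 - a) * (1 - b)) \<le> f_rho (rho i) + s \<and>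
           f_rho (rho i) - s \<le> (rho i - a\<^sup>2) / (1 - a)\<^sup>2"
      and e: "e < 1 / (?B + 1)"
      and disc: "discretization M K g" and feas: "feasible_relaxed M K g rho w"
      and cells: "\<forall>i\<in>vertiports M. k i \<in> {1..K i} \<and> g i (k i) \<le> rho i \<and> rho i \<le> g i (k i + 1)"
      and no_tie: "\<not> last_cell_tie M K w k"
      and width: "\<forall>i\<in>vertiports M. g i (k i + 1) - g i (k i) \<le> e"
    have k: "k i \<in> {1..K i}" "g i (k i) \<le> rho i" "rho i \<le> g i (k i + 1)"
      "g i (k i + 1) - g i (k i) \<le> e" if "i \<in> vertiports M" for i
      using cells width that by blast+
    have dom: "var_domains M rho w" and lin: "linear_constraints M rho w"
      and Theta0: "\<And>i. i \<in> vertiports M \<Longrightarrow> 0 \<le> vTheta w i"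
      and Theta: "\<And>i k. i \<in> vertiports M \<Longrightarrow> k \<in> {1..K i} \<Longrightarrow>
        (rho i - (g i k)\<^sup>2) / (1 - g i k)\<^sup>2 \<le> vTheta w i"
      and flt: "(\<Sum>i\<in>vertiports M. vTheta w i)
         + (\<Sum>i\<in>vertiports M. \<Sum>j\<in>vertiports M. tf M i j * (vpsi w i j + vphi w i j))
         \<le> real_of_int (vGamma w)"
      using feas unfolding feasible_relaxed_def by blast+
    have "(\<Sum>i\<in>vertiports M. vTheta w i) \<le> ?B"
      using feasible_relaxed_sum_Theta_le[OF valid feas] vGamma_le[OF dom lin] by linarith
    then have Theta_le: "vTheta w i \<le> ?B" if "i \<in> vertiports M" for i
      using member_le_sum[OF that, of "vTheta w"] Theta0 finN by force
    have not_last: "k i \<noteq> K i" if i: "i \<in> vertiports M" for i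
    proof
      assume last: "k i = K i"
      let ?a = "g i (k i)"
      have a: "?a < 1" using disc i k(1)[OF i] by (intro discretization_less_1[OF disc]) auto
      have "g i (k i + 1) = 1" using disc i last by (simp add: discretization_def)
      then have "1 - ?a < 1 / (?B + 1)" using k(4)[OF i] e by linarith
      then have "(1 - ?a) * (?B + 1) < 1" using B by (simp add: field_simps)
      \<comment> \<open>The tangent at \<open>?a\<close> takes the value \<open>f_rho ?a\<close>
        there and is increasing, so at \<open>rho i\<close> it is at least that large, although
        \<open>vTheta w i\<close> is at most \<open>?B\<close>.\<close>
      moreover have "?a / (1 - ?a) = (?a - ?a\<^sup>2) / (1 - ?a)\<^sup>2"
        using a by (simp add: divide_simps power2_eq_square) algebra
      then have "?a / (1 - ?a) \<le> (rho i - ?a\<^sup>2) / (1 - ?a)\<^sup>2"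
        using k(2)[OF i] by (simp add: divide_right_mono)
      then have "?a / (1 - ?a) \<le> ?B"
        using Theta[OF i k(1)[OF i]] Theta_le[OF i] by linarith
      then have "?a \<le> ?B * (1 - ?a)" using a by (simp add: field_simps)
      ultimately show False by (simp add: algebra_simps)
    qed
    have lt1: "g i (k i + 1) < 1" if i: "i \<in> vertiports M" for i
      using disc i k(1)[OF i] not_last[OF i] by (intro discretization_less_1[OF disc]) auto
    have err_k: "(rho i - g i (k i) * g i (k i + 1)) / ((1 - g i (k i)) * (1 - g i (k i + 1)))
          \<le> f_rho (rho i) + s"
      "f_rho (rho i) - s \<le> (rho i - (g i (k i))\<^sup>2) / (1 - g i (k i))\<^sup>2"
      if i: "i \<in> vertiports M" for i
      using err i k(2,3,4)[OF i] lt1[OF i] by blast+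
    have "\<forall>i\<in>vertiports M. rho i < 1"
      using k(3) lt1 by force
    moreover have "phi_feasible M rho (vpsi w) (vGamma w) (\<lambda>(i, j). vphi w i j) t"
      unfolding phi_feasible_def prod.case
    proof (intro conjI ballI)
      fix i j assume "i \<in> vertiports M" "j \<in> vertiports M"
      then show "0 \<le> vphi w i j" using dom unfolding var_domains_def by blast
    next
      fix i assume "i \<in> vertiports M"
      then show "(\<Sum>j\<in>vertiports M. vpsi w j i + vphi w j i) = (\<Sum>j\<in>vertiports M. vpsi w i j + vphi w i j)"
        using lin unfolding linear_constraints_def by blast
    next
      have "(\<Sum>i\<in>vertiports M. f_rho (rho i)) \<le> (\<Sum>i\<in>vertiports M. vTheta w i + s)"
      proof (rule sum_mono)
        fix i assume i: "i \<in> vertiports M"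
        show "f_rho (rho i) \<le> vTheta w i + s"
          using err_k(2)[OF i] Theta[OF i k(1)[OF i]] by linarith
      qed
      also have "\<dots> = (\<Sum>i\<in>vertiports M. vTheta w i) + real (card (vertiports M)) * s"
        by (simp add: sum.distrib)
      finally show "(\<Sum>i\<in>vertiports M. f_rho (rho i))
         + (\<Sum>i\<in>vertiports M. \<Sum>j\<in>vertiports M. tf M i j * (vpsi w i j + vphi w i j))
         \<le> real_of_int (vGamma w) + t"
        using flt s(3) by linarith
    next
      fix i assume i: "i \<in> vertiports M"
      \<comment> \<open>Since \<open>k i\<close> is not the last cell, selecting the last cell at
        \<open>i\<close> would be a tie; hence the charging constraint is not vacuous.\<close>
      have "vbeta w i (K i) \<noteq> 1"
        using no_tie not_last[OF i] i unfolding last_cell_tie_def by blast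
      then have "bfly M / bchg M * (\<Sum>j\<in>vertiports M. tf M i j * (vpsi w i j + vphi w i j))
          \<le> f_rho (rho i) + s"
        using disc feas i k[OF i] not_last[OF i] err_k(1)[OF i] s(1)
        by (intro charging_bound) auto
      then show "bfly M / bchg M * (\<Sum>j\<in>vertiports M. tf M i j * (vpsi w i j + vphi w i j))
          \<le> f_rho (rho i) + t"
        using s(2) by linarith
    qed
    ultimately show "(\<forall>i\<in>vertiports M. rho i < 1) \<and>
        phi_feasible M rho (vpsi w) (vGamma w) (\<lambda>(i, j). vphi w i j) t" ..
  qed
qed

section \<open>Replacing the flows and choosing the constants\<close>

lemma objective_eq_phi_cost:
  "objective M v = objective M (v\<lparr>vphi := \<lambda>_ _. 0\<rparr>) + phi_cost M (\<lambda>(i, j). vphi v i j)"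
  by (simp add: objective_def phi_cost_def distrib_left sum.distrib)

text \<open>The flows \<phi> occur only in their sign condition, the flow balance, (F) and (C),
  which are the four conjuncts of \<open>phi_feasible\<close>. All other constraints carry over from
  \<open>w\<close>, and the objective changes only by the flow cost.\<close>

lemma feasible_star_of_phi_feasible:
  fixes w :: "('r, 'n) relaxed_vars"
  assumes dom: "var_domains M rho w" and lin: "linear_constraints M rho w"
    and rho1: "\<forall>i\<in>vertiports M. rho i < 1"
    and x: "phi_feasible M rho (vpsi w) (vGamma w) x 0"
  shows "\<exists>nu :: ('r, 'n) vars. feasible_star M rho nu \<and>
           objective M nu = objective M w - phi_cost M (\<lambda>(i, j). vphi w i j) + phi_cost M x"
proof -
  define nu :: "('r, 'n) vars" where
    "nu = \<lparr>vx = vx w, vz = vz w, vy = vy w, vGamma = vGamma w, valpha = valpha w,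
           vpsi = vpsi w, vphi = (\<lambda>i j. x (i, j))\<rparr>"
  have nu: "vx nu = vx w" "vz nu = vz w" "vy nu = vy w" "vGamma nu = vGamma w"
    "valpha nu = valpha w" "vpsi nu = vpsi w" "vphi nu = (\<lambda>i j. x (i, j))"
    by (simp_all add: nu_def)
  have x0: "\<forall>i\<in>vertiports M. \<forall>j\<in>vertiports M. 0 \<le> x (i, j)"
    and bal: "\<forall>i\<in>vertiports M. (\<Sum>j\<in>vertiports M. vpsi w j i + x (j, i))
                        = (\<Sum>j\<in>vertiports M. vpsi w i j + x (i, j))"
    and flt: "(\<Sum>i\<in>vertiports M. f_rho (rho i))
       + (\<Sum>i\<in>vertiports M. \<Sum>j\<in>vertiports M. tf M i j * (vpsi w i j + x (i, j)))
       \<le> real_of_int (vGamma w) + 0"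
    and chg: "\<forall>i\<in>vertiports M.
        bfly M / bchg M * (\<Sum>j\<in>vertiports M. tf M i j * (vpsi w i j + x (i, j)))
          \<le> f_rho (rho i) + 0"
    using x unfolding phi_feasible_def by blast+
  have "var_domains M rho nu"
    using dom x0 unfolding var_domains_def nu by blast
  moreover have "linear_constraints M rho nu"
    using lin bal unfolding linear_constraints_def nu by blast
  moreover have "(\<Sum>i\<in>vertiports M. f_rho (rho i))
       + (\<Sum>i\<in>vertiports M. \<Sum>j\<in>vertiports M. tf M i j * (vpsi nu i j + vphi nu i j))
       \<le> real_of_int (vGamma nu)"
    using flt unfolding nu by simp
  moreover have "\<forall>i\<in>vertiports M.
        bfly M / bchg M * (\<Sum>j\<in>vertiports M. tf M i j * (vpsi nu i j + vphi nu i j))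
          - f_rho (rho i) \<le> 0"
    using chg unfolding nu by simp
  ultimately have "feasible_star M rho nu"
    using rho1 unfolding feasible_star_def by blast
  moreover have "objective M (nu\<lparr>vphi := \<lambda>_ _. 0\<rparr>) = objective M (w\<lparr>vphi := \<lambda>_ _. 0\<rparr>)"
    by (simp add: objective_def nu_def)
  then have "objective M nu = objective M w - phi_cost M (\<lambda>(i, j). vphi w i j) + phi_cost M x"
    using objective_eq_phi_cost[of M nu] objective_eq_phi_cost[of M w] by (simp add: nu)
  ultimately show ?thesis by blast
qed

text \<open>\<open>S0\<close> precedes the grid and the relaxed solution in the quantifier order, so
  it depends only on the data, \<open>eps\<close> and \<open>rhoR\<close>. Only in a tie may
  \<open>S\<close> depend on the grid.\<close>

theorem theorem2:
  fixes M :: "('r, 'n) vp_data" and eps :: real and rhoR :: "'n \<Rightarrow> real"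
  assumes "valid_data M" and "eps > 0"
  shows "\<exists>S0>0. \<forall>(K :: 'n \<Rightarrow> nat) (g :: 'n \<Rightarrow> nat \<Rightarrow> real) (nuR :: ('r, 'n) relaxed_vars) (k :: 'n \<Rightarrow> nat).
           discretization M K g \<longrightarrow>
           optimal_relaxed M K g rhoR nuR \<longrightarrow>
           (\<forall>i\<in>vertiports M. k i \<in> {1..K i} \<and> g i (k i) \<le> rhoR i \<and> rhoR i \<le> g i (k i + 1)) \<longrightarrow>
           (\<exists>S>0. (S = S0 \<or> last_cell_tie M K nuR k) \<and>
              ((\<forall>i\<in>vertiports M. g i (k i + 1) - g i (k i) \<le> S * eps) \<longrightarrow>
               (\<exists>nu :: ('r, 'n) vars. feasible_star M rhoR nu \<and>
                  ereal (objective M nu) \<le> opt_value_star M + ereal eps)))"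
proof -
  \<comment> \<open>First \<open>t\<close> is taken small enough for exact flows to exist at extra
    cost \<open>eps\<close>; then a width \<open>e\<close> is taken that keeps the relaxation error
    below this \<open>t\<close>.\<close>
  have "\<forall>\<^sub>F t in at_right 0. 0 < t \<and> (\<forall>(w :: ('r, 'n) relaxed_vars) x.
           var_domains M rhoR w \<longrightarrow> linear_constraints M rhoR w \<longrightarrow> 0 \<le> vGamma w \<longrightarrow>
           phi_feasible M rhoR (vpsi w) (vGamma w) x t \<longrightarrow>
           (\<exists>x'. phi_feasible M rhoR (vpsi w) (vGamma w) x' 0 \<and> phi_cost M x' \<le> phi_cost M x + eps))"
    by (intro eventually_conj eventually_at_right_less phi_feasible_repair assms)
  then obtain t :: real where t: "0 < t"
    and repair: "\<And>(w :: ('r, 'n) relaxed_vars) x.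
           var_domains M rhoR w \<Longrightarrow> linear_constraints M rhoR w \<Longrightarrow> 0 \<le> vGamma w \<Longrightarrow>
           phi_feasible M rhoR (vpsi w) (vGamma w) x t \<Longrightarrow>
           \<exists>x'. phi_feasible M rhoR (vpsi w) (vGamma w) x' 0 \<and> phi_cost M x' \<le> phi_cost M x + eps"
    using eventually_happens'[OF trivial_limit_at_right_real] by blast
  have "\<forall>\<^sub>F e in at_right 0. 0 < e \<and> (\<forall>K g (w :: ('r, 'n) relaxed_vars) k.
           discretization M K g \<longrightarrow> feasible_relaxed M K g rhoR w \<longrightarrow>
           (\<forall>i\<in>vertiports M. k i \<in> {1..K i} \<and> g i (k i) \<le> rhoR i \<and> rhoR i \<le> g i (k i + 1)) \<longrightarrow>
           \<not> last_cell_tie M K w k \<longrightarrow>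
           (\<forall>i\<in>vertiports M. g i (k i + 1) - g i (k i) \<le> e) \<longrightarrow>
           (\<forall>i\<in>vertiports M. rhoR i < 1) \<and>
           phi_feasible M rhoR (vpsi w) (vGamma w) (\<lambda>(i, j). vphi w i j) t)"
    by (intro eventually_conj eventually_at_right_less feasible_relaxed_imp_phi_feasible assms t)
  then obtain e :: real where e: "0 < e"
    and near: "\<And>K g (w :: ('r, 'n) relaxed_vars) k.
           discretization M K g \<Longrightarrow> feasible_relaxed M K g rhoR w \<Longrightarrow>
           (\<forall>i\<in>vertiports M. k i \<in> {1..K i} \<and> g i (k i) \<le> rhoR i \<and> rhoR i \<le> g i (k i + 1)) \<Longrightarrow>
           \<not> last_cell_tie M K w k \<Longrightarrow>
           (\<forall>i\<in>vertiports M. g i (k i + 1) - g i (k i) \<le> e) \<Longrightarrow>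
           (\<forall>i\<in>vertiports M. rhoR i < 1) \<and>
           phi_feasible M rhoR (vpsi w) (vGamma w) (\<lambda>(i, j). vphi w i j) t"
    using eventually_happens'[OF trivial_limit_at_right_real] by blast
  show ?thesis
  \<comment> \<open>With this \<open>S0\<close> the width condition \<open>S0 * eps\<close> is
    exactly \<open>e\<close>.\<close>
  proof (rule exI[of _ "e / eps"], intro conjI allI impI)
    show "0 < e / eps" using e assms(2) by simp
    fix K g k and nuR :: "('r, 'n) relaxed_vars"
    assume disc: "discretization M K g" and opt: "optimal_relaxed M K g rhoR nuR"
      and cells: "\<forall>i\<in>vertiports M. k i \<in> {1..K i} \<and> g i (k i) \<le> rhoR i \<and> rhoR i \<le> g i (k i + 1)"
    show "\<exists>S>0. (S = e / eps \<or> last_cell_tie M K nuR k) \<and>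
              ((\<forall>i\<in>vertiports M. g i (k i + 1) - g i (k i) \<le> S * eps) \<longrightarrow>
               (\<exists>nu :: ('r, 'n) vars. feasible_star M rhoR nu \<and>
                  ereal (objective M nu) \<le> opt_value_star M + ereal eps))"
    proof (cases "last_cell_tie M K nuR k")
      case True
      \<comment> \<open>Choosing \<open>S\<close> below the width of a cell makes the width condition unsatisfiable.\<close>
      then obtain i where i: "i \<in> vertiports M"
        unfolding last_cell_tie_def by blast
      define d where "d = g i (k i + 1) - g i (k i)"
      have "d > 0"
        using disc i cells unfolding discretization_def d_def by auto
      then have "\<not> d \<le> d / 2 / eps * eps" "d / 2 / eps > 0"
        using assms(2) by simp_all
      then show ?thesis
        using True i unfolding d_def by blast
    next
      case False
      have "\<exists>nu :: ('r, 'n) vars. feasible_star M rhoR nu \<and>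
              ereal (objective M nu) \<le> opt_value_star M + ereal eps"
        if width: "\<forall>i\<in>vertiports M. g i (k i + 1) - g i (k i) \<le> e / eps * eps"
      proof -
        have feas: "feasible_relaxed M K g rhoR nuR"
          using opt unfolding optimal_relaxed_def by blast
        then have dom: "var_domains M rhoR nuR" and lin: "linear_constraints M rhoR nuR"
          unfolding feasible_relaxed_def by blast+
        have rho1: "\<forall>i\<in>vertiports M. rhoR i < 1"
          and phi: "phi_feasible M rhoR (vpsi nuR) (vGamma nuR) (\<lambda>(i, j). vphi nuR i j) t"
          using near[OF disc feas cells False] width assms(2) by simp_all
        obtain x where x: "phi_feasible M rhoR (vpsi nuR) (vGamma nuR) x 0"
          "phi_cost M x \<le> phi_cost M (\<lambda>(i, j). vphi nuR i j) + eps"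
          using repair[OF dom lin feasible_relaxed_vGamma_nonneg[OF assms(1) feas] phi] by blast
        obtain nu :: "('r, 'n) vars" where nu: "feasible_star M rhoR nu"
          "objective M nu = objective M nuR - phi_cost M (\<lambda>(i, j). vphi nuR i j) + phi_cost M x"
          using feasible_star_of_phi_feasible[OF dom lin rho1 x(1)] by blast
        have "ereal (objective M nu) \<le> ereal (objective M nuR) + ereal eps"
          using x(2) nu(2) by simp
        also have "\<dots> \<le> opt_value_star M + ereal eps"
          by (intro add_right_mono optimal_relaxed_le_opt_value_star[OF disc opt])
        finally show ?thesis using nu(1) by blast
      qed
      moreover have "0 < e / eps" using e assms(2) by simp
      ultimately show ?thesis by blast
    qed
  qed
qed

end
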